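(* Let $r\in\mathbb{Z}_{\ge0}$. The generating function $F_r^{\le}(z,t)$ of Catalan--Stanley trees of age at most $r$, where $t$ marks the rightmost leaves of the branches attached to the root and $z$ marks all other nodes, is \[ F_r^{\le}(z,t) = \frac{z}{1 - t\,\frac{1-T^{2r}}{1-T^{2}}}, \qquad T=T(z)=\frac{1-\sqrt{1-4z}}{2}. \]
   Context: A rooted plane tree has ordered children at every node. For each child $c$ of the root, the rightmost leaf of the branch at $c$ is the leaf reached from $c$ by repeatedly moving to the rightmost child. A Catalan--Stanley tree is a rooted plane tree in which every such rightmost leaf has odd distance to the root (the one-node tree is included). The reduction $\rho$ on Catalan--Stanley trees: for each rightmost leaf $\ell$ of a branch attached to the root, if $\ell$ is a child of the root it is deleted; otherwise all descendants of the grandparent of $\ell$ are deleted (the grandparent becomes a leaf); the one-node tree is mapped to itself. The age $\alpha(\tau)$ of a Catalan--Stanley tree $\tau$ is the least $r\ge0$ such that $\rho^{r}(\tau)$ is the one-node tree (equivalently, the number of expansions $\rho^{-1}$ needed to grow $\tau$ from the one-node tree). $T(z)$ is the generating function of rooted plane trees by number of nodes. *)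

theory Defs
  imports Complex_Main "HOL-Computational_Algebra.Formal_Power_Series"
begin

datatype plane_tree = Node (children: "plane_tree list")

fun num_nodes :: "plane_tree \<Rightarrow> nat" where
  "num_nodes (Node ts) = Suc (\<Sum>c\<leftarrow>ts. num_nodes c)"

text \<open>
  A node is addressed by the list of child indices (from 0, left to right) on the path leading to
  it, so the length of an address is the distance of the node from the top of the tree, and
  \<open>butlast\<close> yields the address of the parent.
\<close>

function rightmost_path :: "plane_tree \<Rightarrow> nat list" where
  "rightmost_path (Node ts) =
     (if ts = [] then [] else (length ts - 1) # rightmost_path (last ts))"
  by pat_completeness auto
termination
  by (relation "measure size") (auto simp: less_Suc_eq_le intro: size_list_estimation' last_in_set)

definition branch_leaves :: "plane_tree \<Rightarrow> nat list set" where
  "branch_leaves \<tau> = {i # rightmost_path (children \<tau> ! i) | i. i < length (children \<tau>)}"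

definition catalan_stanley :: "plane_tree \<Rightarrow> bool" where
  "catalan_stanley \<tau> \<longleftrightarrow> (\<forall>l\<in>branch_leaves \<tau>. odd (length l))"

text \<open>Deletes all proper descendants of the node at the given address.\<close>

fun cut_below :: "nat list \<Rightarrow> plane_tree \<Rightarrow> plane_tree" where
  "cut_below [] (Node ts) = Node []"
| "cut_below (i # p) (Node ts) = Node (ts[i := cut_below p (ts ! i)])"

text \<open>
  The branch at a child \<open>c\<close> of the root is a single node exactly when its rightmost leaf is a child
  of the root. Otherwise, in a Catalan--Stanley tree, \<open>rightmost_path c\<close> has even length at least
  2, so the grandparent of the leaf lies in the branch and has the address below relative to \<open>c\<close>.
  Off Catalan--Stanley trees the values of \<open>reduction\<close> have no meaning.
\<close>

definition reduce_branch :: "plane_tree \<Rightarrow> plane_tree list" where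
  "reduce_branch c =
     (if c = Node [] then [] else [cut_below (butlast (butlast (rightmost_path c))) c])"

definition reduction :: "plane_tree \<Rightarrow> plane_tree" where
  "reduction \<tau> = Node (concat (map reduce_branch (children \<tau>)))"

definition age :: "plane_tree \<Rightarrow> nat" where
  "age \<tau> = (LEAST r. (reduction ^^ r) \<tau> = Node [])"

lemma finite_num_nodes_le: "finite {\<tau>. num_nodes \<tau> \<le> n}"
proof (induction n)
  case 0
  have "num_nodes \<tau> > 0" for \<tau>
    by (cases \<tau>) simp
  then have "{\<tau>. num_nodes \<tau> \<le> 0} = {}"
    by auto
  then show ?case by (metis finite.emptyI)
next
  case (Suc n)
  have len: "length ts \<le> (\<Sum>c\<leftarrow>ts. num_nodes c)" for ts
  proof (induction ts)
    case (Cons c ts)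
    then show ?case by (cases c) simp
  qed simp
  have mem: "num_nodes c \<le> (\<Sum>c\<leftarrow>ts. num_nodes c)" if "c \<in> set ts" for c ts
    using that by (intro member_le_sum_list) auto
  have "{\<tau>. num_nodes \<tau> \<le> Suc n} \<subseteq>
      Node ` {ts. set ts \<subseteq> {\<tau>. num_nodes \<tau> \<le> n} \<and> length ts \<le> n}"
  proof
    fix \<tau> assume a: "\<tau> \<in> {\<tau>. num_nodes \<tau> \<le> Suc n}"
    obtain ts where ts: "\<tau> = Node ts" by (cases \<tau>)
    with a have "(\<Sum>c\<leftarrow>ts. num_nodes c) \<le> n" by simp
    with len[of ts] mem[of _ ts] have "set ts \<subseteq> {\<tau>. num_nodes \<tau> \<le> n} \<and> length ts \<le> n"
      by (auto intro: order_trans)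
    with ts show "\<tau> \<in> Node ` {ts. set ts \<subseteq> {\<tau>. num_nodes \<tau> \<le> n} \<and> length ts \<le> n}" by blast
  qed
  then show ?case
    using finite_lists_length_le[OF Suc.IH] finite_subset by blast
qed

text \<open>The sets counted in the two generating functions are finite by the preceding lemma.\<close>

definition plane_tree_gf :: "real fps" where
  "plane_tree_gf = Abs_fps (\<lambda>n. of_nat (card {\<tau>. num_nodes \<tau> = n}))"

text \<open>
  Bivariate series are series in \<open>t\<close> (outer) over series in \<open>z\<close> (inner): \<open>t\<close> is
  \<open>fps_X\<close>, \<open>z\<close> is \<open>fps_const fps_X\<close>, and the coefficient of \<open>t^m z^n\<close> is \<open>fps_nth (fps_nth F m) n\<close>.
\<close>

definition age_le_gf :: "nat \<Rightarrow> real fps fps" where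
  "age_le_gf r = Abs_fps (\<lambda>m. Abs_fps (\<lambda>n. of_nat (card
     {\<tau>. catalan_stanley \<tau> \<and> age \<tau> \<le> r \<and>
         card (branch_leaves \<tau>) = m \<and> num_nodes \<tau> = m + n})))"

end

theory Submission
  imports Defs
begin

unbundle fps_syntax

text \<open>
  A branch whose rightmost leaf has distance \<open>k\<close> from the top of the branch is a chain of \<open>k\<close>
  nodes, each carrying an arbitrary forest to the left of the chain, followed by the leaf. As
  \<open>T = z / (1 - T)\<close>, such branches contribute \<open>t T^k\<close>. One reduction step shortens every rightmost
  path by 2 and removes the branches of length 0, so age at most \<open>r\<close> means that all these lengths
  are even and less than \<open>2 r\<close>; the series is then a sequence construction over a finite geometric
  sum.
\<close>

subsection \<open>Counting series of weighted sets\<close>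

text \<open>\<open>card\<close> is 0 on infinite sets, so a coefficient is meaningful only for a
  finite weight class; hence the finiteness premises in the rules for unions and products.\<close>

definition counting_series :: "('a \<Rightarrow> nat) \<Rightarrow> 'a set \<Rightarrow> real fps" where
  "counting_series w A = Abs_fps (\<lambda>n. of_nat (card {x \<in> A. w x = n}))"

lemma counting_series_singleton: "counting_series w {a} = fps_X ^ w a"
proof (rule fps_ext)
  fix n
  have "{x \<in> {a}. w x = n} = (if n = w a then {a} else {})" by auto
  then show "counting_series w {a} $ n = (fps_X ^ w a) $ n"
    by (simp add: counting_series_def)
qed

lemma counting_series_Un_disjoint:
  assumes "\<And>n. finite {x \<in> A. w x = n}" "\<And>n. finite {x \<in> B. w x = n}" "A \<inter> B = {}"
  shows "counting_series w (A \<union> B) = counting_series w A + counting_series w B"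
proof (rule fps_ext)
  fix n
  have "{x \<in> A \<union> B. w x = n} = {x \<in> A. w x = n} \<union> {x \<in> B. w x = n}" by auto
  moreover have "{x \<in> A. w x = n} \<inter> {x \<in> B. w x = n} = {}" using assms(3) by auto
  ultimately have "card {x \<in> A \<union> B. w x = n} = card {x \<in> A. w x = n} + card {x \<in> B. w x = n}"
    using assms(1,2) by (simp only: card_Un_disjoint)
  then show "counting_series w (A \<union> B) $ n = (counting_series w A + counting_series w B) $ n"
    by (simp only: counting_series_def fps_add_nth fps_nth_Abs_fps of_nat_add)
qed

lemma counting_series_shift:
  assumes "inj_on f A" "\<And>a. a \<in> A \<Longrightarrow> u (f a) = w a + k"
  shows "counting_series u (f ` A) = fps_X ^ k * counting_series w A"
proof (rule fps_ext)
  fix n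
  have "card {x \<in> f ` A. u x = n} = (if n < k then 0 else card {x \<in> A. w x = n - k})"
  proof (cases "n < k")
    case True
    then have "{x \<in> f ` A. u x = n} = {}" using assms(2) by auto
    then show ?thesis using True by (simp only: card.empty if_True)
  next
    case False
    then have "{x \<in> f ` A. u x = n} = f ` {x \<in> A. w x = n - k}" using assms(2) by auto
    moreover have "inj_on f {x \<in> A. w x = n - k}" using assms(1) by (auto intro: inj_on_subset)
    ultimately show ?thesis using False by (simp add: card_image)
  qed
  then show "counting_series u (f ` A) $ n = (fps_X ^ k * counting_series w A) $ n"
    by (simp add: counting_series_def fps_X_power_mult_nth)
qed

text \<open>Cauchy product: a pair of total weight n has first weight i and second weight n - i, and
  distinct i give disjoint blocks of pairs.\<close>

lemma counting_series_pairs: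
  assumes fin: "\<And>n. finite {x \<in> A. w x = n}" "\<And>n. finite {x \<in> B. v x = n}"
    and inj: "inj_on f (A \<times> B)"
    and wt: "\<And>a b. a \<in> A \<Longrightarrow> b \<in> B \<Longrightarrow> u (f (a, b)) = w a + v b"
  shows "counting_series u (f ` (A \<times> B)) = counting_series w A * counting_series v B"
proof (rule fps_ext)
  fix n
  let ?P = "\<lambda>i. {x \<in> A. w x = i} \<times> {x \<in> B. v x = n - i}"
  have eq: "{x \<in> f ` (A \<times> B). u x = n} = f ` (\<Union>i\<in>{0..n}. ?P i)"
  proof (intro equalityI subsetI)
    fix x assume "x \<in> {x \<in> f ` (A \<times> B). u x = n}"
    then obtain a b where ab: "a \<in> A" "b \<in> B" "x = f (a, b)" "w a + v b = n" using wt by auto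
    then have "(a, b) \<in> ?P (w a)" "w a \<in> {0..n}" by auto
    then show "x \<in> f ` (\<Union>i\<in>{0..n}. ?P i)" using ab(3) by blast
  next
    fix x assume "x \<in> f ` (\<Union>i\<in>{0..n}. ?P i)"
    then show "x \<in> {x \<in> f ` (A \<times> B). u x = n}" using wt by auto
  qed
  have "inj_on f (\<Union>i\<in>{0..n}. ?P i)"
    by (rule inj_on_subset[OF inj]) auto
  then have "card {x \<in> f ` (A \<times> B). u x = n} = card (\<Union>i\<in>{0..n}. ?P i)"
    unfolding eq by (rule card_image)
  also have "\<dots> = (\<Sum>i\<in>{0..n}. card (?P i))"
    using fin by (intro card_UN_disjoint) auto
  finally show "counting_series u (f ` (A \<times> B)) $ n =
      (counting_series w A * counting_series v B) $ n"
    by (simp add: counting_series_def fps_mult_nth card_cartesian_product)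
qed

subsection \<open>Plane trees and forests\<close>

abbreviation forest_size :: "plane_tree list \<Rightarrow> nat" where
  "forest_size ts \<equiv> \<Sum>c\<leftarrow>ts. num_nodes c"

lemma finite_trees: "finite {\<tau> \<in> A. num_nodes \<tau> = n}"
  by (rule finite_subset[OF _ finite_num_nodes_le[of n]]) auto

text \<open>Putting a root on a forest adds exactly one node, so finiteness is inherited from trees
  through the injection \<open>Node\<close>.\<close>

lemma finite_forests: "finite {ts \<in> A. forest_size ts = n}"
proof (rule finite_imageD)
  show "finite (Node ` {ts \<in> A. forest_size ts = n})"
    by (rule finite_subset[OF _ finite_num_nodes_le[of "Suc n"]]) auto
  show "inj_on Node {ts \<in> A. forest_size ts = n}" by (auto simp: inj_on_def)
qed

lemma counting_series_Node:
  "counting_series num_nodes (Node ` A) = fps_X * counting_series forest_size A"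
  using counting_series_shift[of Node A num_nodes forest_size 1] by (auto simp: inj_on_def)

lemma counting_series_Cons:
  "counting_series forest_size ((\<lambda>(c, ts). c # ts) ` (A \<times> B)) =
     counting_series num_nodes A * counting_series forest_size B"
  by (rule counting_series_pairs) (auto simp: finite_trees finite_forests inj_on_def)

text \<open>Splitting off the last tree instead of the first follows the rightmost path, which
  always descends into the last child.\<close>

lemma counting_series_snoc:
  "counting_series forest_size ((\<lambda>(ts, c). ts @ [c]) ` (B \<times> A)) =
     counting_series forest_size B * counting_series num_nodes A"
  by (rule counting_series_pairs) (auto simp: finite_trees finite_forests inj_on_def)

lemma plane_tree_gf_eq: "plane_tree_gf = counting_series num_nodes UNIV"
  by (simp add: plane_tree_gf_def counting_series_def)

text \<open>The forest series plays the role of 1 / (1 - T), so this is T = z / (1 - T) without a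
  division.\<close>

lemma plane_tree_gf_forests: "plane_tree_gf = fps_X * counting_series forest_size UNIV"
proof -
  have "range Node = UNIV" by (metis surj_def plane_tree.exhaust)
  then show ?thesis using counting_series_Node[of UNIV] by (simp add: plane_tree_gf_eq)
qed

lemma counting_series_forests:
  "counting_series forest_size UNIV = 1 + plane_tree_gf * counting_series forest_size UNIV"
proof -
  have "(UNIV :: plane_tree list set) = {[]} \<union> (\<lambda>(c, ts). c # ts) ` (UNIV \<times> UNIV)"
  proof -
    have "ts \<in> {[]} \<union> (\<lambda>(c, ts). c # ts) ` (UNIV \<times> UNIV)" for ts :: "plane_tree list"
      by (cases ts) auto
    then show ?thesis by blast
  qed
  then have "counting_series forest_size UNIV =
      counting_series forest_size ({[]} \<union> (\<lambda>(c, ts). c # ts) ` (UNIV \<times> UNIV))"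
    by (rule arg_cong)
  also have "\<dots> = counting_series forest_size {[]} +
      counting_series forest_size ((\<lambda>(c, ts). c # ts) ` (UNIV \<times> UNIV))"
    by (rule counting_series_Un_disjoint) (auto simp only: finite_forests)
  finally show ?thesis
    by (simp only: counting_series_singleton counting_series_Cons plane_tree_gf_eq) simp
qed

lemma plane_tree_gf_quadratic: "plane_tree_gf = fps_X + plane_tree_gf\<^sup>2"
proof -
  have "plane_tree_gf = fps_X * (1 + plane_tree_gf * counting_series forest_size UNIV)"
    by (subst counting_series_forests[symmetric]) (rule plane_tree_gf_forests)
  also have "\<dots> = fps_X + plane_tree_gf * (fps_X * counting_series forest_size UNIV)"
    by (simp add: algebra_simps)
  finally show ?thesis by (simp only: plane_tree_gf_forests[symmetric] power2_eq_square)
qed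

lemma plane_tree_gf_nth_0: "plane_tree_gf $ 0 = 0"
  by (subst plane_tree_gf_forests) simp

lemma plane_tree_gf_closed_form:
  "plane_tree_gf = (1 - fps_radical root 2 (1 - 4 * fps_X)) / 2"
proof -
  let ?T = plane_tree_gf
  have four: "(4 :: real fps) $ 0 = 4" by (simp add: numeral_fps_const)
  have sq: "(1 - 2 * ?T) ^ Suc 1 = 1 - 4 * fps_X"
  proof -
    have "?T - ?T\<^sup>2 = fps_X" using plane_tree_gf_quadratic by (metis add_diff_cancel_right')
    moreover have "(1 - 2 * ?T) ^ Suc 1 = 1 - 4 * (?T - ?T\<^sup>2)"
      by (simp add: power2_eq_square algebra_simps)
    ultimately show ?thesis by simp
  qed
  \<comment> \<open>The quadratic has two roots. Since T has constant term 0, 1 - 2 T has constant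
    term 1 and is therefore the radical and not its negative.\<close>
  have "1 - 2 * ?T = fps_radical root (Suc 1) (1 - 4 * fps_X)"
    using sq radical_unique[of root 1 "1 - 4 * fps_X" "1 - 2 * ?T"] four
    by (simp add: plane_tree_gf_nth_0)
  then have "1 - fps_radical root 2 (1 - 4 * fps_X) = 2 * ?T"
    by (simp add: numeral_2_eq_2 algebra_simps)
  then show ?thesis by simp
qed

subsection \<open>Branches by length of the rightmost path\<close>

definition depth_trees :: "nat \<Rightarrow> plane_tree set" where
  "depth_trees k = {c. length (rightmost_path c) = k}"

lemma depth_trees_0: "depth_trees 0 = {Node []}"
proof -
  have "length (rightmost_path c) = 0 \<longleftrightarrow> c = Node []" for c by (cases c) simp
  then show ?thesis by (simp add: depth_trees_def)
qed

lemma depth_trees_Suc: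
  "depth_trees (Suc k) = Node ` ((\<lambda>(ts, c). ts @ [c]) ` (UNIV \<times> depth_trees k))"
proof (intro equalityI subsetI)
  fix \<tau> assume *: "\<tau> \<in> depth_trees (Suc k)"
  obtain us where us: "\<tau> = Node us" by (cases \<tau>)
  with * have "us \<noteq> []" by (auto simp: depth_trees_def)
  then obtain ts c where "us = ts @ [c]" by (metis append_butlast_last_id)
  with * us show "\<tau> \<in> Node ` ((\<lambda>(ts, c). ts @ [c]) ` (UNIV \<times> depth_trees k))"
    by (force simp: depth_trees_def)
qed (auto simp: depth_trees_def)

text \<open>Each inner node of the rightmost path, with the forest to its left, gives a factor z /
  (1 - T) = T. The remaining \<open>fps_X\<close> is the leaf, which still weighs z here instead of
  t.\<close>

lemma counting_series_depth_trees:
  "counting_series num_nodes (depth_trees k) = fps_X * plane_tree_gf ^ k"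
proof (induction k)
  case 0
  then show ?case by (simp add: depth_trees_0 counting_series_singleton)
next
  case (Suc k)
  have "counting_series num_nodes (depth_trees (Suc k)) =
      (fps_X * counting_series forest_size UNIV) * counting_series num_nodes (depth_trees k)"
    by (simp only: depth_trees_Suc counting_series_Node counting_series_snoc mult.assoc)
  then show ?case
    by (simp only: Suc plane_tree_gf_forests[symmetric]) (simp add: algebra_simps)
qed

text \<open>These are the branches allowed below the root at age at most r. Lengths are measured
  from the top of the branch, one less than the distance to the root, so odd becomes even.\<close>

definition young_branches :: "nat \<Rightarrow> plane_tree set" where
  "young_branches r = {c. even (length (rightmost_path c)) \<and> length (rightmost_path c) < 2 * r}"

lemma counting_series_young_branches:
  "counting_series num_nodes (young_branches r) = fps_X * (\<Sum>k<r. plane_tree_gf ^ (2 * k))"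
proof (induction r)
  case 0
  then show ?case by (simp add: young_branches_def counting_series_def fps_eq_iff)
next
  case (Suc r)
  \<comment> \<open>Raising the bound from 2r to 2r + 2 admits only the length 2r, because 2r + 1 is
    odd.\<close>
  have "young_branches (Suc r) = young_branches r \<union> depth_trees (2 * r)"
    by (auto simp: young_branches_def depth_trees_def elim!: evenE)
  moreover have "young_branches r \<inter> depth_trees (2 * r) = {}"
    by (auto simp: young_branches_def depth_trees_def)
  ultimately have "counting_series num_nodes (young_branches (Suc r)) =
      counting_series num_nodes (young_branches r) + counting_series num_nodes (depth_trees (2 * r))"
    by (simp add: counting_series_Un_disjoint finite_trees)
  then show ?case by (simp add: Suc counting_series_depth_trees algebra_simps)
qed

lemma counting_series_lists_of_length:
  "counting_series forest_size {ts. set ts \<subseteq> A \<and> length ts = m} = counting_series num_nodes A ^ m"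
proof (induction m)
  case 0
  have "{ts. set ts \<subseteq> A \<and> length ts = 0} = {[]}" by auto
  then show ?case by (simp only: counting_series_singleton) simp
next
  case (Suc m)
  have "{ts. set ts \<subseteq> A \<and> length ts = Suc m} =
      (\<lambda>(c, ts). c # ts) ` (A \<times> {ts. set ts \<subseteq> A \<and> length ts = m})"
    by (auto simp: length_Suc_conv image_def)
  then show ?case by (simp only: counting_series_Cons Suc power_Suc)
qed

subsection \<open>Reduction and age\<close>

lemma branch_leaves_conv:
  "branch_leaves (Node ts) = (\<lambda>i. i # rightmost_path (ts ! i)) ` {..<length ts}"
  by (auto simp: branch_leaves_def)

text \<open>The addresses start with different child indices, so no two branches share a
  leaf.\<close>

lemma card_branch_leaves: "card (branch_leaves (Node ts)) = length ts"
  unfolding branch_leaves_conv by (subst card_image) (auto simp: inj_on_def)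

lemma catalan_stanley_iff:
  "catalan_stanley (Node ts) \<longleftrightarrow> (\<forall>c\<in>set ts. even (length (rightmost_path c)))"
  unfolding catalan_stanley_def branch_leaves_conv all_set_conv_all_nth by simp blast

text \<open>A node on the rightmost path becomes the rightmost leaf once its descendants are gone.
  The prefix length \<open>k\<close> is arbitrary because it drops by one at each descent of the
  induction.\<close>

lemma rightmost_path_cut_below:
  "rightmost_path (cut_below (take k (rightmost_path c)) c) = take k (rightmost_path c)"
proof (induction c arbitrary: k rule: rightmost_path.induct)
  case (1 ts)
  show ?case
  proof (cases "ts = [] \<or> k = 0")
    case True
    then show ?thesis by auto
  next
    case False
    then obtain j where "k = Suc j" "ts \<noteq> []" by (cases k) auto
    moreover have "last (ts[length ts - 1 := x]) = x" for x
      using \<open>ts \<noteq> []\<close> by (simp add: last_conv_nth)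
    ultimately show ?thesis using 1[of j] by (simp add: last_conv_nth)
  qed
qed

lemma rightmost_path_reduced_branch:
  "rightmost_path (cut_below (butlast (butlast (rightmost_path c))) c) =
     butlast (butlast (rightmost_path c))"
proof -
  have "butlast (butlast xs) = take (length xs - 2) xs" for xs :: "nat list"
    by (simp add: butlast_conv_take min_absorb1 numeral_2_eq_2)
  then show ?thesis by (simp only: rightmost_path_cut_below)
qed

text \<open>Age depends only on the set of path lengths, and reduction acts on this set alone.
  \<open>Node []\<close> is taken out explicitly, since truncated subtraction would keep its length
  0.\<close>

lemma rightmost_path_lengths_reduction:
  "(\<lambda>c. length (rightmost_path c)) ` set (children (reduction (Node ts))) =
     (\<lambda>c. length (rightmost_path c) - 2) ` (set ts - {Node []})"
proof -
  have "set (children (reduction (Node ts))) =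
      (\<lambda>c. cut_below (butlast (butlast (rightmost_path c))) c) ` (set ts - {Node []})"
    unfolding reduction_def reduce_branch_def by (auto split: if_splits)
  then show ?thesis
    by (simp add: image_image rightmost_path_reduced_branch numeral_2_eq_2)
qed

lemma reduction_funpow_eq_leaf_iff:
  assumes "catalan_stanley \<tau>"
  shows "(reduction ^^ r) \<tau> = Node [] \<longleftrightarrow>
    (\<forall>c\<in>set (children \<tau>). length (rightmost_path c) < 2 * r)"
  using assms
proof (induction r arbitrary: \<tau>)
  case 0
  then show ?case by (cases \<tau>) auto
next
  case (Suc r)
  obtain ts where \<tau>: "\<tau> = Node ts" by (cases \<tau>)
  \<comment> \<open>An arbitrary \<open>P\<close> lets the same fact carry evenness, which keeps the
    reduced tree Catalan--Stanley, and the length bound.\<close>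
  have all: "(\<forall>c\<in>set (children (reduction \<tau>)). P (length (rightmost_path c))) \<longleftrightarrow>
      (\<forall>c\<in>set ts - {Node []}. P (length (rightmost_path c) - 2))" for P
    using arg_cong[OF rightmost_path_lengths_reduction[of ts], of "\<lambda>S. \<forall>x\<in>S. P x"]
    by (simp add: \<tau>)
  have ev: "\<forall>c\<in>set ts. even (length (rightmost_path c))"
    using Suc.prems by (simp add: \<tau> catalan_stanley_iff)
  have pos: "length (rightmost_path c) > 0" if "c \<noteq> Node []" for c
    using that depth_trees_0 by (auto simp: depth_trees_def)
  have "\<forall>c\<in>set (children (reduction \<tau>)). even (length (rightmost_path c))"
    unfolding all using ev by auto
  then have cs: "catalan_stanley (reduction \<tau>)"
    by (metis catalan_stanley_iff plane_tree.collapse)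
  have "(reduction ^^ Suc r) \<tau> = Node [] \<longleftrightarrow> (reduction ^^ r) (reduction \<tau>) = Node []"
    by (simp only: funpow_Suc_right o_apply)
  also have "\<dots> \<longleftrightarrow> (\<forall>c\<in>set ts - {Node []}. length (rightmost_path c) - 2 < 2 * r)"
    using Suc.IH[OF cs] all[of "\<lambda>l. l < 2 * r"] by simp
  also have "\<dots> \<longleftrightarrow> (\<forall>c\<in>set ts. length (rightmost_path c) < 2 * Suc r)"
  proof -
    have "(c \<noteq> Node [] \<longrightarrow> length (rightmost_path c) - 2 < 2 * r) \<longleftrightarrow>
        length (rightmost_path c) < 2 * Suc r" if "c \<in> set ts" for c
    proof (cases "c = Node []")
      case False
      \<comment> \<open>A positive even length is at least 2, so the subtraction is not
        truncated.\<close>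
      then have "length (rightmost_path c) \<ge> 2"
        using pos[of c] ev that by (metis dvd_imp_le)
      then show ?thesis using False by auto
    qed simp
    then show ?thesis by blast
  qed
  finally show ?case by (simp add: \<tau>)
qed

lemma age_le_iff:
  assumes "catalan_stanley \<tau>"
  shows "age \<tau> \<le> r \<longleftrightarrow> (\<forall>c\<in>set (children \<tau>). length (rightmost_path c) < 2 * r)"
proof -
  let ?P = "\<lambda>r. \<forall>c\<in>set (children \<tau>). length (rightmost_path c) < 2 * r"
  have age: "age \<tau> = (LEAST r. ?P r)"
    by (simp add: age_def reduction_funpow_eq_leaf_iff[OF assms])
  \<comment> \<open>The sum of all path lengths bounds each of them. This witness shows that the age
    is attained, so \<open>LEAST\<close> is not applied to an empty set.\<close>
  have "length (rightmost_path c) < 2 * Suc (\<Sum>c\<leftarrow>children \<tau>. length (rightmost_path c))"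
    if "c \<in> set (children \<tau>)" for c
    using member_le_sum_list[of "length (rightmost_path c)"
        "map (\<lambda>c. length (rightmost_path c)) (children \<tau>)"] that by simp
  then have "\<exists>r. ?P r" by blast
  then have least: "?P (age \<tau>)" unfolding age by (rule LeastI_ex)
  show ?thesis
  proof
    assume "age \<tau> \<le> r"
    then show "?P r" using least by fastforce
  next
    assume "?P r"
    then show "age \<tau> \<le> r" unfolding age by (rule Least_le)
  qed
qed

text \<open>With m branches, the m marked leaves contribute z^m to the series by total size; reading
  the coefficient at m + n strips this factor. The remaining \<open>fps_X\<close> is the
  root.\<close>

lemma age_le_gf_nth: "age_le_gf r $ m = fps_X * (\<Sum>k<r. plane_tree_gf ^ (2 * k)) ^ m"
proof (rule fps_ext)
  fix n
  let ?G = "\<Sum>k<r. plane_tree_gf ^ (2 * k)"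
  let ?A = "Node ` {ts. set ts \<subseteq> young_branches r \<and> length ts = m}"
  have "catalan_stanley \<tau> \<and> age \<tau> \<le> r \<and> card (branch_leaves \<tau>) = m \<longleftrightarrow> \<tau> \<in> ?A" for \<tau>
  proof -
    obtain ts where "\<tau> = Node ts" by (cases \<tau>)
    then show ?thesis
      using age_le_iff[of \<tau> r]
      by (auto simp: catalan_stanley_iff card_branch_leaves young_branches_def)
  qed
  then have "{\<tau>. catalan_stanley \<tau> \<and> age \<tau> \<le> r \<and> card (branch_leaves \<tau>) = m \<and>
      num_nodes \<tau> = m + n} = {\<tau> \<in> ?A. num_nodes \<tau> = m + n}" by blast
  then have "age_le_gf r $ m $ n = counting_series num_nodes ?A $ (m + n)"
    by (simp add: age_le_gf_def counting_series_def)
  also have "counting_series num_nodes ?A = fps_X ^ m * (fps_X * ?G ^ m)"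
    by (simp only: counting_series_Node counting_series_lists_of_length
        counting_series_young_branches power_mult_distrib mult.left_commute)
  finally show "age_le_gf r $ m $ n = (fps_X * ?G ^ m) $ n"
    by (simp add: fps_X_power_mult_nth)
qed

section \<open>Summation over the number of branches\<close>

theorem mainTheorem5:
  fixes r :: nat
  shows "let T = plane_tree_gf;
             z = fps_const fps_X;
             t = fps_X
         in T = (1 - fps_radical root 2 (1 - 4 * fps_X)) / 2 \<and>
            age_le_gf r = z / (1 - t * fps_const ((1 - T ^ (2 * r)) / (1 - T ^ 2)))"
proof -
  let ?T = plane_tree_gf
  define G where "G = (\<Sum>k<r. ?T ^ (2 * k))"
  have "(1 - ?T\<^sup>2) * G = 1 - ?T ^ (2 * r)"
    unfolding G_def using one_diff_power_eq[of "?T\<^sup>2" r] by (simp add: power_mult)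
  moreover have "(1 - ?T\<^sup>2) \<noteq> 0"
  proof
    assume "1 - ?T\<^sup>2 = 0"
    then have "(1 - ?T\<^sup>2) $ 0 = 0" by simp
    then show False by (simp add: power2_eq_square plane_tree_gf_nth_0)
  qed
  ultimately have G: "(1 - ?T ^ (2 * r)) / (1 - ?T\<^sup>2) = G"
    using nonzero_mult_div_cancel_left[of "1 - ?T\<^sup>2" G] by (simp only: not_False_eq_True)
  let ?D = "1 - fps_X * fps_const G"
  \<comment> \<open>Coefficients in t are compared: at 0 only z remains, and at m + 1 the terms z
    G^(m+1) and G (z G^m) cancel.\<close>
  have "age_le_gf r * ?D = fps_const fps_X"
  proof (rule fps_ext)
    fix m
    have "age_le_gf r * ?D = age_le_gf r - fps_X * (fps_const G * age_le_gf r)"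
      by (simp add: algebra_simps)
    then show "(age_le_gf r * ?D) $ m = fps_const fps_X $ m"
      by (cases m) (simp_all add: age_le_gf_nth flip: G_def)
  qed
  then have "age_le_gf r * (?D * inverse ?D) = fps_const fps_X * inverse ?D"
    by (simp only: mult.assoc[symmetric])
  \<comment> \<open>The coefficients in t are power series in z, which do not form a field;
    \<open>inverse\<close> is a true inverse here because the constant coefficient of
    \<open>?D\<close> is 1.\<close>
  moreover have "?D * inverse ?D = 1"
    using fps_right_inverse[of ?D 1] by (simp add: fps_inverse_def fps_lr_inverse_one_one)
  ultimately have "age_le_gf r = fps_const fps_X * inverse ?D"
    by (simp only: mult.right_neutral)
  also have "\<dots> = fps_const fps_X / ?D"
    by (rule fps_divide_unit[symmetric]) simp
  finally have "age_le_gf r = fps_const fps_X / ?D" .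
  then show ?thesis
    unfolding Let_def G using plane_tree_gf_closed_form by (intro conjI)
qed

end
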